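(* Let $(A,\cdot)$ be an anti-flexible algebra over a field $\mathbb{K}$ of characteristic different from $2$, let $M$ be an $A$-bimodule, and let $T:M\to A$ be an $\mathcal{O}$-operator on $A$ with respect to the bimodule $M$. Then $T$ induces a left-symmetric algebra structure $\star$ and a right-symmetric algebra structure $\ast$ on $M$, given for all $m,n\in M$ by $$m\star n=T(m)n-nT(m),\qquad m\ast n=mT(n)-T(n)m.$$
   Context: An anti-flexible algebra is a $\mathbb{K}$-vector space $A$ with a bilinear product $\cdot$ such that $(x\cdot y)\cdot z-x\cdot(y\cdot z)=(z\cdot y)\cdot x-z\cdot(y\cdot x)$ for all $x,y,z\in A$. An $A$-bimodule is a vector space $M$ with bilinear left and right actions $A\times M\to M$, $(a,m)\mapsto am$, and $M\times A\to M$, $(m,a)\mapsto ma$, such that for all $a,b\in A$, $m\in M$: $(a\cdot b)m-a(bm)-(mb)a+m(b\cdot a)=0$ and $a(mb)-(am)b-b(ma)+(bm)a=0$. An $\mathcal{O}$-operator on $A$ with respect to $M$ is a linear map $T:M\to A$ with $T(m)\cdot T(n)=T(mT(n)+T(m)n)$ for all $m,n\in M$. A vector space with a bilinear product $\circ$ is a left-symmetric algebra if $(x\circ y)\circ z-x\circ(y\circ z)=(y\circ x)\circ z-y\circ(x\circ z)$ for all $x,y,z$, and a right-symmetric algebra if $(x\circ y)\circ z-x\circ(y\circ z)=(x\circ z)\circ y-x\circ(z\circ y)$ for all $x,y,z$. *)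

theory Defs
  imports Complex_Main
begin

text \<open>Vector spaces are given by a scalar multiplication on a type of class ab_group_add,
  as in the locale \<^locale>\<open>vector_space\<close>. The predicate \<open>Vector_Spaces.linear\<close> includes
  the vector space axioms for its source and target.\<close>

definition bilinear_map ::
  "('k::field \<Rightarrow> 'u::ab_group_add \<Rightarrow> 'u) \<Rightarrow> ('k \<Rightarrow> 'v::ab_group_add \<Rightarrow> 'v) \<Rightarrow>
   ('k \<Rightarrow> 'w::ab_group_add \<Rightarrow> 'w) \<Rightarrow> ('u \<Rightarrow> 'v \<Rightarrow> 'w) \<Rightarrow> bool" where
  "bilinear_map s1 s2 s3 f \<longleftrightarrow>
     (\<forall>x. Vector_Spaces.linear s2 s3 (\<lambda>y. f x y)) \<and>
     (\<forall>y. Vector_Spaces.linear s1 s3 (\<lambda>x. f x y))"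

locale nonassoc_algebra = vector_space scale
  for scale :: "'k::field \<Rightarrow> 'a::ab_group_add \<Rightarrow> 'a" +
  fixes mult :: "'a \<Rightarrow> 'a \<Rightarrow> 'a" (infixl "\<bullet>" 70)
  assumes bilinear_mult: "bilinear_map scale scale scale mult"

locale anti_flexible_algebra = nonassoc_algebra +
  assumes anti_flexible:
    "(x \<bullet> y) \<bullet> z - x \<bullet> (y \<bullet> z) = (z \<bullet> y) \<bullet> x - z \<bullet> (y \<bullet> x)"

locale left_symmetric_algebra = nonassoc_algebra +
  assumes left_symmetric:
    "(x \<bullet> y) \<bullet> z - x \<bullet> (y \<bullet> z) = (y \<bullet> x) \<bullet> z - y \<bullet> (x \<bullet> z)"

locale right_symmetric_algebra = nonassoc_algebra +
  assumes right_symmetric: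
    "(x \<bullet> y) \<bullet> z - x \<bullet> (y \<bullet> z) = (x \<bullet> z) \<bullet> y - x \<bullet> (z \<bullet> y)"

locale anti_flexible_bimodule =
  A: anti_flexible_algebra scaleA mult + M: vector_space scaleM
  for scaleA :: "'k::field \<Rightarrow> 'a::ab_group_add \<Rightarrow> 'a"
    and mult :: "'a \<Rightarrow> 'a \<Rightarrow> 'a" (infixl "\<bullet>" 70)
    and scaleM :: "'k \<Rightarrow> 'm::ab_group_add \<Rightarrow> 'm" +
  fixes lact :: "'a \<Rightarrow> 'm \<Rightarrow> 'm" (infixr "\<rhd>" 72)
    and ract :: "'m \<Rightarrow> 'a \<Rightarrow> 'm" (infixl "\<lhd>" 72)
  assumes bilinear_lact: "bilinear_map scaleA scaleM scaleM lact"
    and bilinear_ract: "bilinear_map scaleM scaleA scaleM ract"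
    and bimodule_mult: "((a \<bullet> b) \<rhd> m) - (a \<rhd> (b \<rhd> m)) - ((m \<lhd> b) \<lhd> a) + (m \<lhd> (b \<bullet> a)) = 0"
    and bimodule_comm: "(a \<rhd> (m \<lhd> b)) - ((a \<rhd> m) \<lhd> b) - (b \<rhd> (m \<lhd> a)) + ((b \<rhd> m) \<lhd> a) = 0"

locale O_operator =
  anti_flexible_bimodule scaleA mult scaleM lact ract + T: Vector_Spaces.linear scaleM scaleA T
  for scaleA :: "'k::field \<Rightarrow> 'a::ab_group_add \<Rightarrow> 'a"
    and mult :: "'a \<Rightarrow> 'a \<Rightarrow> 'a" (infixl "\<bullet>" 70)
    and scaleM :: "'k \<Rightarrow> 'm::ab_group_add \<Rightarrow> 'm"
    and lact :: "'a \<Rightarrow> 'm \<Rightarrow> 'm" (infixr "\<rhd>" 72)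
    and ract :: "'m \<Rightarrow> 'a \<Rightarrow> 'm" (infixl "\<lhd>" 72)
    and T :: "'m \<Rightarrow> 'a" +
  assumes O_identity: "T m \<bullet> T n = T ((m \<lhd> T n) + (T m \<rhd> n))"

end

theory Submission
  imports Defs
begin

text \<open>Writing \<open>D a m = am - ma\<close>, the two bimodule identities combine to
  \<open>D (ab - ba) = D a \<circ> D b - D b \<circ> D a\<close>. The \<open>\<O>\<close>-operator identity gives
  \<open>T (m \<star> n - n \<star> m) = T m \<cdot> T n - T n \<cdot> T m\<close>, so left symmetry of
  \<open>m \<star> n = D (T m) n\<close> is this commutator relation. Since \<open>m \<ast> n = - (n \<star> m)\<close>,
  right symmetry is left symmetry read in the opposite algebra.\<close>

lemma bilinear_map_linear_right: "bilinear_map s1 s2 s3 f \<Longrightarrow> Vector_Spaces.linear s2 s3 (f x)"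
  and bilinear_map_linear_left: "bilinear_map s1 s2 s3 f \<Longrightarrow> Vector_Spaces.linear s1 s3 (\<lambda>x. f x y)"
  by (auto simp: bilinear_map_def)

lemmas bilinear_map_diff =
    bilinear_map_linear_left[THEN module_hom_linearI, THEN module_hom.diff]
    bilinear_map_linear_right[THEN module_hom_linearI, THEN module_hom.diff]
  and bilinear_map_neg =
    bilinear_map_linear_left[THEN module_hom_linearI, THEN module_hom.neg]
    bilinear_map_linear_right[THEN module_hom_linearI, THEN module_hom.neg]

lemma bilinear_map_compose_left:
  assumes "bilinear_map s1 s2 s3 f" and "Vector_Spaces.linear s0 s1 g"
  shows "bilinear_map s0 s2 s3 (\<lambda>x. f (g x))"
  using assms Vector_Spaces.linear_compose[OF assms(2), unfolded comp_def]
  unfolding bilinear_map_def by blast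

lemma bilinear_map_swap: "bilinear_map s1 s2 s3 f \<Longrightarrow> bilinear_map s2 s1 s3 (\<lambda>x y. f y x)"
  by (simp add: bilinear_map_def)

lemma bilinear_map_sub:
  assumes "bilinear_map s1 s2 s3 f" and "bilinear_map s1 s2 s3 g"
  shows "bilinear_map s1 s2 s3 (\<lambda>x y. f x y - g x y)"
proof -
  interpret vector_space_pair s1 s3
    using bilinear_map_linear_left[OF assms(1)] by (simp add: vector_space_pair_def Vector_Spaces.linear_iff)
  interpret R: vector_space_pair s2 s3
    using bilinear_map_linear_right[OF assms(1)] by (simp add: vector_space_pair_def Vector_Spaces.linear_iff)
  show ?thesis
    using assms unfolding bilinear_map_def by (simp add: linear_compose_sub R.linear_compose_sub)
qed

text \<open>Solves a bimodule identity for its first term, making it a rewrite rule.\<close>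

lemma eq_of_four_term_zero: "x - y - z + w = 0 \<Longrightarrow> x = y + z - w"
  for w x y z :: "'a::ab_group_add"
  by (simp add: algebra_simps eq_neg_iff_add_eq_0)

context anti_flexible_bimodule
begin

text \<open>The operator \<open>D a\<close> of the overview.\<close>

definition bracket :: "'a \<Rightarrow> 'm \<Rightarrow> 'm" where
  "bracket a m = lact a m - ract m a"

lemma bilinear_bracket: "bilinear_map scaleA scaleM scaleM bracket"
  unfolding bracket_def
  by (intro bilinear_map_sub bilinear_lact bilinear_map_swap[OF bilinear_ract])

text \<open>Antisymmetrising \<open>bimodule_mult\<close> in \<open>a\<close> and \<open>b\<close>
  leaves only the pure terms a(bm), (mb)a, b(am), (ma)b; the mixed terms on the right, such as
  a(mb), cancel by \<open>bimodule_comm\<close>.\<close>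

lemma bracket_commutator:
  "bracket (mult a b - mult b a) m = bracket a (bracket b m) - bracket b (bracket a m)"
proof -
  have mult_act: "lact (mult c d) m = lact c (lact d m) + ract (ract m d) c - ract m (mult d c)" for c d
    by (rule eq_of_four_term_zero[OF bimodule_mult])
  \<comment> \<open>Kept at fixed \<open>a\<close> and \<open>b\<close>: for arbitrary pairs the
    rule would also rewrite \<open>lact b (ract m a)\<close> and loop.\<close>
  have comm_act: "lact a (ract m b) = ract (lact a m) b + lact b (ract m a) - ract (lact b m) a"
    by (rule eq_of_four_term_zero[OF bimodule_comm])
  show ?thesis
    unfolding bracket_def bilinear_map_diff[OF bilinear_lact] bilinear_map_diff[OF bilinear_ract]
      mult_act comm_act
    by (simp add: algebra_simps)
qed

end

context O_operator
begin

text \<open>The argument of \<open>T\<close> regroups as (m T(n) + T(m) n) - (n T(m) + T(n) m), two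
  instances of the argument in \<open>O_identity\<close>.\<close>

lemma T_bracket_diff:
  "T (bracket (T m) n - bracket (T n) m) = mult (T m) (T n) - mult (T n) (T m)"
  unfolding O_identity T.diff[symmetric] by (simp add: bracket_def algebra_simps)

lemma bilinear_bracket_T: "bilinear_map scaleM scaleM scaleM (\<lambda>m. bracket (T m))"
  using bilinear_bracket T.linear_axioms by (rule bilinear_map_compose_left)

lemma bracket_T_symmetric:
  "bracket (T (bracket (T m) n)) p - bracket (T m) (bracket (T n) p) =
   bracket (T (bracket (T n) m)) p - bracket (T n) (bracket (T m) p)"
  using bracket_commutator[of "T m" "T n" p, folded T_bracket_diff]
  by (simp add: T.diff bilinear_map_diff[OF bilinear_bracket] algebra_simps)

lemma left_symmetric_algebra_bracket:
  "left_symmetric_algebra scaleM (\<lambda>m. bracket (T m))"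
  by unfold_locales (rule bilinear_bracket_T bracket_T_symmetric)+

lemma right_symmetric_algebra_bracket:
  "right_symmetric_algebra scaleM (\<lambda>m n. - bracket (T n) m)"
proof unfold_locales
  have "bilinear_map scaleM scaleM scaleM (\<lambda>m n. ract m (T n) - lact (T n) m)"
    \<comment> \<open>Precomposition with \<open>T\<close> is available for the left argument only,
      hence the swaps.\<close>
    by (rule bilinear_map_sub[OF
          bilinear_map_compose_left[OF bilinear_map_swap[OF bilinear_ract] T.linear_axioms,
            THEN bilinear_map_swap]
          bilinear_map_compose_left[OF bilinear_lact T.linear_axioms, THEN bilinear_map_swap]])
  then show "bilinear_map scaleM scaleM scaleM (\<lambda>m n. - bracket (T n) m)"
    by (simp add: bracket_def)
next
  fix x y z
  show "- bracket (T z) (- bracket (T y) x) - - bracket (T (- bracket (T z) y)) x =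
    - bracket (T y) (- bracket (T z) x) - - bracket (T (- bracket (T y) z)) x"
    \<comment> \<open>The associator of x, y, z for \<ast> is minus that of z, y, x for \<star>, so
      exchanging \<open>y\<close> and \<open>z\<close> is left symmetry with \<open>x\<close> in the
      last place.\<close>
    using bracket_T_symmetric[of y z x]
    by (simp add: T.neg bilinear_map_neg[OF bilinear_bracket] algebra_simps)
qed

end

theorem theorem3p9:
  fixes scaleA :: "'k::field \<Rightarrow> 'a::ab_group_add \<Rightarrow> 'a"
    and mult :: "'a \<Rightarrow> 'a \<Rightarrow> 'a"
    and scaleM :: "'k \<Rightarrow> 'm::ab_group_add \<Rightarrow> 'm"
    and lact :: "'a \<Rightarrow> 'm \<Rightarrow> 'm"
    and ract :: "'m \<Rightarrow> 'a \<Rightarrow> 'm"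
    and T :: "'m \<Rightarrow> 'a"
  assumes "CHAR('k) \<noteq> 2"
    and "anti_flexible_algebra scaleA mult"
    and "anti_flexible_bimodule scaleA mult scaleM lact ract"
    and "O_operator scaleA mult scaleM lact ract T"
  shows "left_symmetric_algebra scaleM (\<lambda>m n. lact (T m) n - ract n (T m)) \<and>
         right_symmetric_algebra scaleM (\<lambda>m n. ract m (T n) - lact (T n) m)"
proof -
  interpret O_operator scaleA mult scaleM lact ract T by fact
  show ?thesis
    using left_symmetric_algebra_bracket right_symmetric_algebra_bracket
    by (simp add: bracket_def[abs_def])
qed

end
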